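(* Let $\gamma\in(0,1]$, $\lambda>0$ and $c>0$. For $a>0$ small enough that $\kappa=1-ac\in[0,1)$, let $X$ be a $\mathrm{PDS}(\gamma,\lambda,\kappa)$ random variable with $\kappa=1-ac$, let $X^a=aX$, and let $f^a$ be the characteristic function of $X^a$, that is, $$f^a(t)=\exp\left\{-\lambda\left(\frac{1-e^{\mathrm{i}at}}{1-\kappa e^{\mathrm{i}at}}\right)^{\gamma}\right\}.$$ Then for every $t\in\mathbb{R}$ $$f^a(t)\longrightarrow\varphi(t)=\exp\left\{-\lambda\left(\frac{-\mathrm{i}t}{c-\mathrm{i}t}\right)^{\gamma}\right\}\qquad\text{as } a\to0.$$
   Context: For $\gamma\in(0,1]$, $\lambda>0$, $\kappa\in[0,1)$, $\mathrm{PDS}(\gamma,\lambda,\kappa)$ denotes the distribution on $\mathbb{N}_0$ with probability generating function $\mathrm{E}z^X=\exp\left\{-\lambda\left(\frac{1-z}{1-\kappa z}\right)^{\gamma}\right\}$. Complex powers are principal values. The limit is over $a\downarrow0$. *)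

theory Defs
  imports "HOL-Probability.Probability"
begin

definition pgf :: "'a measure \<Rightarrow> ('a \<Rightarrow> nat) \<Rightarrow> complex \<Rightarrow> complex" where
  "pgf M X z = (\<integral>\<omega>. z ^ X \<omega> \<partial>M)"

text \<open>
  The power is the principal value: \<open>powr\<close> on \<^typ>\<open>complex\<close> uses the principal branch of the
  logarithm, and \<open>0 powr \<gamma> = 0\<close>, which is the intended value of the base at \<open>z = 1\<close>.
  The identity is required on the closed unit disc, where the generating function converges.
\<close>

definition PDS_pgf :: "real \<Rightarrow> real \<Rightarrow> real \<Rightarrow> complex \<Rightarrow> complex" where
  "PDS_pgf \<gamma> l \<kappa> z =
     exp (- (of_real l * ((1 - z) / (1 - of_real \<kappa> * z)) powr of_real \<gamma>))"

definition PDS_distributed ::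
  "'a measure \<Rightarrow> ('a \<Rightarrow> nat) \<Rightarrow> real \<Rightarrow> real \<Rightarrow> real \<Rightarrow> bool" where
  "PDS_distributed M X \<gamma> l \<kappa> \<longleftrightarrow>
     prob_space M \<and> X \<in> measurable M (count_space UNIV) \<and>
     (\<forall>z. cmod z \<le> 1 \<longrightarrow> pgf M X z = PDS_pgf \<gamma> l \<kappa> z)"

end

theory Submission
  imports Defs
begin

text \<open>
  The characteristic function of \<open>aX\<close> at \<open>t\<close> is the generating function of \<open>X\<close> at
  \<open>z = e\<^sup>i\<^sup>a\<^sup>t\<close>, a point of the unit circle, so the closed form of \<open>f\<^sup>a\<close> is that of the generating
  function. With \<open>\<kappa> = 1 - ac\<close> the base of the power is
  \<open>(1 - z) / ((1 - z) + acz) = ((1 - z)/a) / ((1 - z)/a + cz)\<close>, and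
  \<open>(1 - z)/a\<close> is minus a difference quotient of \<open>a \<mapsto> e\<^sup>i\<^sup>a\<^sup>t\<close> at \<open>0\<close>, with limit \<open>-it\<close>,
  while \<open>z\<close> tends to \<open>1\<close>. Hence the base tends to \<open>-it/(c - it)\<close>. The real part of that limit is
  \<open>t\<^sup>2/(c\<^sup>2 + t\<^sup>2)\<close>, so for \<open>t \<noteq> 0\<close> it stays off the branch cut and the principal power is continuous
  there. At \<open>t = 0\<close> the base is constantly \<open>0\<close> and so is its power.
\<close>

lemma char_scaled_nat_eq_pgf:
  assumes "X \<in> measurable M (count_space UNIV)"
  shows "char (distr M borel (\<lambda>\<omega>. a * real (X \<omega>))) t = pgf M X (exp (\<i> * of_real (a * t)))"
proof -
  have [measurable]: "X \<in> measurable M (count_space UNIV)" by fact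
  have "char (distr M borel (\<lambda>\<omega>. a * real (X \<omega>))) t
      = (\<integral>\<omega>. iexp (t * (a * real (X \<omega>))) \<partial>M)"
    unfolding char_def by (subst integral_distr) auto
  also have "\<dots> = pgf M X (exp (\<i> * of_real (a * t)))"
    unfolding pgf_def by (simp add: exp_of_nat_mult [symmetric] mult_ac)
  finally show ?thesis .
qed

lemma iexp_difference_quotient_tendsto:
  "((\<lambda>a::real. (1 - exp (\<i> * of_real (a * t))) / of_real a) \<longlongrightarrow> - (\<i> * of_real t)) (at_right 0)"
proof -
  have "((\<lambda>z. exp (\<i> * of_real t * z)) has_field_derivative \<i> * of_real t) (at (0::complex))"
    by (auto intro!: derivative_eq_intros)
  then have quot: "((\<lambda>z. (exp (\<i> * of_real t * z) - 1) / z) \<longlongrightarrow> \<i> * of_real t) (at (0::complex))"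
    by (simp add: DERIV_def)
  have "((\<lambda>a::real. complex_of_real a) \<longlongrightarrow> of_real 0) (at_right 0)"
    by (intro tendsto_intros)
  moreover have "eventually (\<lambda>a::real. complex_of_real a \<noteq> 0) (at_right 0)"
    by (rule eventually_mono[OF eventually_at_right_less[of 0]]) auto
  ultimately have "filterlim (\<lambda>a::real. complex_of_real a) (at 0) (at_right 0)"
    by (simp add: filterlim_at)
  from tendsto_minus[OF filterlim_compose[OF quot this]]
  show ?thesis
    by (simp add: mult_ac minus_divide_left)
qed

text \<open>
  Numerator and denominator both vanish in the limit; dividing each by \<open>a\<close> gives a quotient whose
  denominator tends to \<open>c - it \<noteq> 0\<close>.
\<close>
lemma PDS_base_tendsto:
  fixes c t :: real
  assumes "0 < c"
  shows "((\<lambda>a. (1 - exp (\<i> * of_real (a * t))) /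
               (1 - of_real (1 - a * c) * exp (\<i> * of_real (a * t))))
          \<longlongrightarrow> - (\<i> * of_real t) / (of_real c - \<i> * of_real t)) (at_right 0)"
proof -
  define q where "q a = (1 - exp (\<i> * of_real (a * t))) / of_real a" for a :: real
  have q: "(q \<longlongrightarrow> - (\<i> * of_real t)) (at_right 0)"
    unfolding q_def by (rule iexp_difference_quotient_tendsto)
  have "((\<lambda>a::real. exp (\<i> * of_real (a * t))) \<longlongrightarrow> exp (\<i> * of_real (0 * t))) (at_right 0)"
    by (intro tendsto_intros)
  then have z: "((\<lambda>a::real. exp (\<i> * of_real (a * t))) \<longlongrightarrow> 1) (at_right 0)"
    by simp
  have "- (\<i> * of_real t) + of_real c * 1 \<noteq> 0"
    using assms by (auto simp: complex_eq_iff)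
  then have "((\<lambda>a. q a / (q a + of_real c * exp (\<i> * of_real (a * t))))
      \<longlongrightarrow> - (\<i> * of_real t) / (- (\<i> * of_real t) + of_real c * 1)) (at_right 0)"
    by (intro tendsto_intros q z)
  moreover have "eventually (\<lambda>a::real. q a / (q a + of_real c * exp (\<i> * of_real (a * t)))
      = (1 - exp (\<i> * of_real (a * t))) /
        (1 - of_real (1 - a * c) * exp (\<i> * of_real (a * t)))) (at_right 0)"
    using eventually_at_right_less[of 0]
  proof eventually_elim
    case (elim a)
    have num: "1 - exp (\<i> * of_real (a * t)) = of_real a * q a"
      using elim by (simp add: q_def)
    have den: "1 - of_real (1 - a * c) * exp (\<i> * of_real (a * t))
        = of_real a * (q a + of_real c * exp (\<i> * of_real (a * t)))"
      unfolding distrib_left num [symmetric] by (simp add: algebra_simps)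
    show ?case
      unfolding num den using elim by simp
  qed
  ultimately show ?thesis
    by (simp add: tendsto_cong)
qed

text \<open>
  The real part of the quotient is positive. For \<open>t = 0\<close> the quotient would be \<open>0\<close>, which lies on
  the cut.
\<close>
lemma limit_base_off_branch_cut:
  fixes c t :: real
  assumes "t \<noteq> 0"
  shows "- (\<i> * of_real t) / (of_real c - \<i> * of_real t) \<notin> \<real>\<^sub>\<le>\<^sub>0"
proof -
  have "Re (- (\<i> * of_real t) / (of_real c - \<i> * of_real t)) = t\<^sup>2 / (c\<^sup>2 + t\<^sup>2)"
    by (simp add: Re_divide power2_eq_square)
  moreover have "t\<^sup>2 / (c\<^sup>2 + t\<^sup>2) > 0"
    using assms by (simp add: add_nonneg_pos)
  ultimately show ?thesis
    by (simp add: complex_nonpos_Reals_iff)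
qed

lemma PDS_char_formula_tendsto:
  fixes \<gamma> l c t :: real
  assumes "0 < c"
  shows "((\<lambda>a. exp (- (of_real l *
              ((1 - exp (\<i> * of_real (a * t))) /
               (1 - of_real (1 - a * c) * exp (\<i> * of_real (a * t)))) powr of_real \<gamma>)))
          \<longlongrightarrow> exp (- (of_real l *
              ((- (\<i> * of_real t)) / (of_real c - \<i> * of_real t)) powr of_real \<gamma>))) (at_right 0)"
proof (cases "t = 0")
  case True
  \<comment> \<open>The base is \<open>0\<close> for every \<open>a\<close>, because \<open>e\<^sup>0 = 1\<close>.\<close>
  then show ?thesis by simp
next
  case False
  show ?thesis
    by (intro tendsto_exp tendsto_minus tendsto_mult tendsto_const tendsto_powr_complex
        PDS_base_tendsto[OF assms] limit_base_off_branch_cut[OF False])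
qed

theorem theorem3p10:
  fixes \<gamma> l c :: real
    and M :: "real \<Rightarrow> 'a measure" and X :: "real \<Rightarrow> 'a \<Rightarrow> nat"
    and f :: "real \<Rightarrow> real \<Rightarrow> complex"
  assumes "0 < \<gamma>" and "\<gamma> \<le> 1" and "0 < l" and "0 < c"
    and X: "\<And>a. 0 < a \<Longrightarrow> 1 - a * c \<in> {0..<1} \<Longrightarrow>
              PDS_distributed (M a) (X a) \<gamma> l (1 - a * c)"
    and f: "\<And>a t. 0 < a \<Longrightarrow> 1 - a * c \<in> {0..<1} \<Longrightarrow>
              f a t = char (distr (M a) borel (\<lambda>\<omega>. a * real (X a \<omega>))) t"
  shows "(\<forall>a t. 0 < a \<and> 1 - a * c \<in> {0..<1} \<longrightarrow>
            f a t = exp (- (of_real l *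
              ((1 - exp (\<i> * of_real (a * t))) /
               (1 - of_real (1 - a * c) * exp (\<i> * of_real (a * t)))) powr of_real \<gamma>)))
       \<and> (\<forall>t. ((\<lambda>a. f a t) \<longlongrightarrow>
            exp (- (of_real l *
              ((- (\<i> * of_real t)) / (of_real c - \<i> * of_real t)) powr of_real \<gamma>))) (at_right 0))"
proof -
  have formula: "f a t = exp (- (of_real l *
              ((1 - exp (\<i> * of_real (a * t))) /
               (1 - of_real (1 - a * c) * exp (\<i> * of_real (a * t)))) powr of_real \<gamma>))"
    if "0 < a" "1 - a * c \<in> {0..<1}" for a t
    using X[OF that] f[OF that, of t]
    by (simp add: PDS_distributed_def PDS_pgf_def char_scaled_nat_eq_pgf)
  have "eventually (\<lambda>a. 0 < a \<and> a < 1 / c) (at_right 0)"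
    using \<open>0 < c\<close> by (auto simp: eventually_at_right_field intro!: exI[of _ "1 / c"])
  then have small: "eventually (\<lambda>a. 0 < a \<and> 1 - a * c \<in> {0..<1}) (at_right 0)"
    by eventually_elim (use \<open>0 < c\<close> in \<open>auto simp: field_simps\<close>)
  have "((\<lambda>a. f a t) \<longlongrightarrow>
            exp (- (of_real l *
              ((- (\<i> * of_real t)) / (of_real c - \<i> * of_real t)) powr of_real \<gamma>))) (at_right 0)" for t
    using PDS_char_formula_tendsto[OF \<open>0 < c\<close>]
    by (rule Lim_transform_eventually) (use small in eventually_elim, simp add: formula)
  with formula show ?thesis by blast
qed

end
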